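(* In the codimension-one setting described in the context, let $\beta\in V_{\mathbb{C}}$, $v\in E'_\beta$, $u\in\mathbb{Z}A$, and let $\ell^{(u)}\in\mathbb{Z}^n$ be such that $\sum_{\sigma=1}^n\ell^{(u)}_\sigma\mathbf{a}_\sigma=u$. Suppose that $v$ has minimal $(I,u)$-negative support for all $I\subseteq\{1,\dots,n\}$ with $|I|\ge n-r$, for some integer $r$ with $0\le r<m_v$. Then the expression $$S_{v,u,r}(x):=\sum_{s=0}^r\ \sum_{1\le t_1<\dots<t_s\le r}\ \sum_{p_{t_1},\dots,p_{t_s}=1}^n\Big(\prod_{a=1}^s\epsilon_{p_{t_a}}\ell_{p_{t_a}}\Big)\,\Phi^{(p_{t_1},\dots,p_{t_s})}_{v,\beta+u}(x)\,\log^{r-s}x_0$$ (where $\ell_p$ denotes the positive integer coefficient in the relation on $A$) is a solution of the $A$-hypergeometric system with parameter $\beta+u$ that lies in the Nilsson ring $\mathbb{C}[[x_0]][x_0^{-1},\log x_0,x^v]$.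
   Context: Setting: $A=\{\mathbf{a}_1,\dots,\mathbf{a}_n\}\subseteq\mathbb{Z}^d$, $V\subseteq\mathbb{R}^d$ is the real span of $A$, $V_{\mathbb{C}}\subseteq\mathbb{C}^d$ its complex span, $\mathbb{Z}A$ the abelian group generated by $A$. It is assumed that $\dim V=n-1$ and that each subset of $A$ of cardinality $n-1$ is linearly independent. The lattice of integer relations on $A$ is generated by a single relation $\sum_{i=1}^k \ell_i\mathbf{a}_i-\sum_{j=k+1}^n\ell_j\mathbf{a}_j=\mathbf{0}$, where $1\le k\le n$ and $\ell_1,\dots,\ell_n$ are relatively prime positive integers. Put $\epsilon_p=1$ for $1\le p\le k$ and $\epsilon_p=-1$ for $k+1\le p\le n$; $\ell=(\ell_1,\dots,\ell_k,-\ell_{k+1},\dots,-\ell_n)$; $L=\mathbb{Z}\ell$; $x_0=\prod_{i=1}^kx_i^{\ell_i}/\prod_{j=k+1}^nx_j^{\ell_j}$; and $x^w=\prod_\mu x_\mu^{w_\mu}$ for $w\in\mathbb{C}^n$. The $A$-hypergeometric system with parameter $\gamma=(\gamma_1,\dots,\gamma_d)$ consists of the box operators $\Box_l=\prod_{l_j>0}\partial_j^{l_j}-\prod_{l_j<0}\partial_j^{-l_j}$ for $l\in L$, and the Euler operators $\sum_{j=1}^n a_{ij}x_j\partial_j-\gamma_i$ for $i=1,\dots,d$, where $\mathbf{a}_j=(a_{1j},\dots,a_{dj})$. Operators act on formal series termwise. Exponents: for $i\in\{1,\dots,k\}$, $b\in\{0,\dots,\ell_i-1\}$, $v^{(i,b)}\in\mathbb{C}^n$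 is the unique vector with $v^{(i,b)}_i=b$ and $\sum_\mu v^{(i,b)}_\mu\mathbf{a}_\mu=\beta$. $E_\beta$ is the set of all $v^{(i,b)}$; $E'_\beta=\{v\in E_\beta\mid v_i\notin\mathbb{Z}_{<0}\text{ for }i=1,\dots,k\}$; for $v\in E'_\beta$, $M_v=\{i\in\{1,\dots,k\}\mid v_i\in\mathbb{Z}_{\ge0}\}$ and $m_v=|M_v|$. Negative supports: $L(u)=\{l\in\mathbb{Z}^n\mid\sum_jl_j\mathbf{a}_j=u\}$; for $I\subseteq\{1,\dots,n\}$, $I\text{-nsupp}(w)=\{i\in I\mid w_i\in\mathbb{Z}_{<0}\}$; $v$ has minimal $(I,u)$-negative support if $I\text{-nsupp}(v+l)$ is not a proper subset of $I\text{-nsupp}(v)$ for any $l\in L(u)$. Put $\mathbb{Z}_{v,I}(u,\ell^{(u)})=\{z\in\mathbb{Z}\mid I\text{-nsupp}(v+\ell^{(u)}+z\ell)=I\text{-nsupp}(v)\}$. Constants $M_{l,s}(c)$ ($c\in\mathbb{C}$, $l\in\mathbb{Z}$, $s\in\mathbb{Z}_{\ge0}$): $M_{0,0}(c)=1$ and $M_{0,s}(c)=0$ for $s>0$; for $l>0$ (and $c+l<0$ if $c\in\mathbb{Z}_{<0}$), $M_{l,s}(c)=\frac{(-1)^s}{(c+1)\cdots(c+l)}\sum_{i_1+\cdots+i_l=s}\frac1{(c+1)^{i_1}}\cdots\frac1{(c+l)^{i_l}}$ (sum over nonnegative integers $i_1,\dots,i_l$); for $l<0$, $M_{l,s}(c)=S^{(-l)}_{-l-s}(c,c-1,\dots,c+l+1)$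 if $s\le-l$ and $0$ if $s>-l$, where $S^{(\sigma)}_\tau$ is the elementary symmetric polynomial of degree $\tau$ in $\sigma$ variables. For a finite sequence $Q$ from $\{1,\dots,n\}$ let $\rho_Q(i)$ be the number of times $i$ occurs in $Q$, $\bar Q=\{i\mid\rho_Q(i)>0\}$, $\bar Q^{\rm c}$ its complement in $\{1,\dots,n\}$, and $$\Phi^Q_{v,\beta+u}(x)=x^{v+\ell^{(u)}}\sum_{z\in\mathbb{Z}_{v,\bar Q^{\rm c}}(u,\ell^{(u)})}\Big(\prod_{i=1}^kM_{\ell^{(u)}_i+z\ell_i,\rho_Q(i)}(v_i)\prod_{j=k+1}^nM_{\ell^{(u)}_j-z\ell_j,\rho_Q(j)}(v_j)\Big)x_0^z .$$ (This is independent of the choice of $\ell^{(u)}$. For $s=0$ the term in $S_{v,u,r}$ is $\Phi^\emptyset_{v,\beta+u}(x)\log^rx_0$.)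
   Formalization: Each Φ^Q carries an extra factor ∏ρ_Q(i)! (without it the claim fails for r≥2, e.g. ℓ=(1,1,1), v=0, u=0, r=2); S is shown to lie in x^{ℓ^(u)}·C[[x_0]][x_0^{-1},log x_0,x^v], and in the ring itself only for u=0, as the literal membership fails in general. *)

theory Defs
  imports "HOL-Analysis.Analysis" "HOL-Computational_Algebra.Formal_Power_Series"
begin

text \<open>
  The indices 1, ..., n are the elements of a finite type \<open>'n\<close>; \<open>K :: 'n set\<close> is the set of
  indices with positive sign (1, ..., k in the usual numbering), and \<open>l p\<close> is the positive
  coefficient \<open>\<ell>\<^sub>p\<close>. The points \<open>a p\<close> live in \<open>int^'d\<close>.
\<close>

subsection \<open>Lattices and exponents\<close>

definition rvec :: "int^'m \<Rightarrow> real^'m" where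
  "rvec w = (\<chi> i. of_int (w $ i))"

definition cvec :: "int^'m \<Rightarrow> complex^'m" where
  "cvec w = (\<chi> i. of_int (w $ i))"

definition sgn_coeff :: "'n set \<Rightarrow> 'n \<Rightarrow> int" where
  "sgn_coeff K p = (if p \<in> K then 1 else - 1)"

definition ell :: "'n::finite set \<Rightarrow> ('n \<Rightarrow> int) \<Rightarrow> int^'n" where
  "ell K l = (\<chi> p. sgn_coeff K p * l p)"

definition ZA :: "('n::finite \<Rightarrow> int^'d) \<Rightarrow> (int^'d) set" where
  "ZA a = range (\<lambda>c :: int^'n. \<Sum>j\<in>UNIV. c $ j *s a j)"

definition VC :: "('n::finite \<Rightarrow> int^'d) \<Rightarrow> (complex^'d) set" where
  "VC a = vec.span (range (\<lambda>j. cvec (a j)))"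

definition Lset :: "('n::finite \<Rightarrow> int^'d) \<Rightarrow> int^'d \<Rightarrow> (int^'n) set" where
  "Lset a u = {w. (\<Sum>j\<in>UNIV. w $ j *s a j) = u}"

text \<open>
  The standing assumptions. Linear independence of the subsets of cardinality n - 1 is stated
  for subfamilies, so that the case n = 2, \<open>a\<^sub>1 = a\<^sub>2\<close> is not excluded.
\<close>

definition codim_one :: "('n::finite \<Rightarrow> int^'d) \<Rightarrow> 'n set \<Rightarrow> ('n \<Rightarrow> int) \<Rightarrow> bool" where
  "codim_one a K l \<longleftrightarrow>
     dim (span (range (\<lambda>j. rvec (a j)))) = CARD('n) - 1 \<and>
     (\<forall>J. card J = CARD('n) - 1 \<longrightarrow>
        inj_on (\<lambda>j. rvec (a j)) J \<and> independent ((\<lambda>j. rvec (a j)) ` J)) \<and>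
     K \<noteq> {} \<and> (\<forall>p. l p > 0) \<and> Gcd (range l) = 1 \<and>
     Lset a 0 = range (\<lambda>z. z *s ell K l)"

definition exponent :: "('n::finite \<Rightarrow> int^'d) \<Rightarrow> complex^'d \<Rightarrow> 'n \<Rightarrow> int \<Rightarrow> complex^'n" where
  "exponent a \<beta> i b =
     (THE v. v $ i = of_int b \<and> (\<Sum>j\<in>UNIV. v $ j *s cvec (a j)) = \<beta>)"

lemma exponent_ex1:
  fixes a :: "'n::finite \<Rightarrow> int^'d"
  assumes "codim_one a K l" and "\<beta> \<in> VC a"
  shows "\<exists>!v :: complex^'n. v $ i = of_int b \<and> (\<Sum>j\<in>UNIV. v $ j *s cvec (a j)) = \<beta>"
proof -
  let ?f = "\<lambda>v :: complex^'n. \<Sum>j\<in>UNIV. v $ j *s cvec (a j)"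
  have indep: "inj_on (\<lambda>j. rvec (a j)) (- {i})"
      "independent ((\<lambda>j. rvec (a j)) ` (- {i}))"
    using assms(1) unfolding codim_one_def by (auto simp: Compl_eq_Diff_UNIV card_Diff_subset)
  have l: "l i > 0" and L: "ell K l \<in> Lset a 0"
    using assms(1) unfolding codim_one_def by (auto intro!: image_eqI[of _ _ 1])
  have add: "?f (v + w) = ?f v + ?f w" for v w
    by (simp add: vec.scale_left_distrib sum.distrib)
  have diff: "?f (v - w) = ?f v - ?f w" for v w
    by (simp add: vec.scale_left_diff_distrib sum_subtractf)
  have scale: "?f (c *s v) = c *s ?f v" for c v
    by (simp add: vec.scale_sum_right)
  have rel0: "?f (cvec (ell K l)) = 0"
  proof -
    have "(\<Sum>j\<in>UNIV. ell K l $ j * a j $ q) = 0" for q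
      using L unfolding Lset_def by (auto simp: vec_eq_iff)
    then have "(\<Sum>j\<in>UNIV. of_int (ell K l $ j * a j $ q)) = (0 :: complex)" for q
      by (metis of_int_0 of_int_sum)
    then show ?thesis by (simp add: vec_eq_iff cvec_def)
  qed
  have elli: "cvec (ell K l) $ i \<noteq> 0"
    using l by (auto simp: cvec_def ell_def sgn_coeff_def)
  have inj: "w = 0" if w: "?f w = 0" "w $ i = 0" for w
  proof -
    have real0: "\<forall>j\<in>- {i}. c j = 0" if "(\<Sum>j\<in>- {i}. c j *\<^sub>R rvec (a j)) = 0" for c
    proof -
      let ?r = "\<lambda>j. rvec (a j)"
      let ?g = "the_inv_into (- {i}) ?r"
      have "(\<Sum>x\<in>?r ` (- {i}). c (?g x) *\<^sub>R x) = (\<Sum>j\<in>- {i}. c j *\<^sub>R ?r j)"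
        unfolding sum.reindex[OF indep(1)]
        by (intro sum.cong refl) (simp add: the_inv_into_f_f[OF indep(1)])
      then have sum0: "(\<Sum>x\<in>?r ` (- {i}). c (?g x) *\<^sub>R x) = 0"
        using that by simp
      have "\<forall>x\<in>?r ` (- {i}). c (?g x) = 0"
        using independentD[OF indep(2) _ subset_refl sum0] by simp
      then show ?thesis using the_inv_into_f_f[OF indep(1)] by fastforce
    qed
    have comp: "(\<Sum>j\<in>- {i}. w $ j * of_int (a j $ q)) = 0" for q
    proof -
      have "(\<Sum>j\<in>UNIV. w $ j * of_int (a j $ q)) = 0"
        using w(1) by (auto simp: vec_eq_iff cvec_def)
      then show ?thesis
        using w(2) by (subst (asm) sum.remove[of _ i]) (auto simp: Compl_eq_Diff_UNIV)
    qed
    have "(\<Sum>j\<in>- {i}. Re (w $ j) * of_int (a j $ q)) = 0" for q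
      using arg_cong[OF comp[of q], of Re] by simp
    moreover have "(\<Sum>j\<in>- {i}. Im (w $ j) * of_int (a j $ q)) = 0" for q
      using arg_cong[OF comp[of q], of Im] by simp
    ultimately have "\<forall>j\<in>- {i}. Re (w $ j) = 0" "\<forall>j\<in>- {i}. Im (w $ j) = 0"
      by (intro real0; simp add: vec_eq_iff rvec_def)+
    then have "w $ j = 0" for j
      using w(2) by (cases "j = i") (auto simp: complex_eq_iff)
    then show ?thesis by (simp add: vec_eq_iff)
  qed
  have "\<exists>c. ?f c = \<beta>"
    using assms(2) unfolding VC_def
  proof (induction rule: vec.span_induct_alt)
    case base
    show ?case by (intro exI[of _ 0]) simp
  next
    case (step c x y)
    then obtain d j where "?f d = y" "x = cvec (a j)" by auto
    moreover have "?f (axis j c) = c *s cvec (a j)"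
      by (subst sum.remove[of _ j]) (auto simp: axis_def intro!: sum.neutral)
    ultimately have "?f (axis j c + d) = c *s x + y" by (simp only: add)
    then show ?case by blast
  qed
  then obtain c where c: "?f c = \<beta>" by blast
  define t where "t = (of_int b - c $ i) / cvec (ell K l) $ i"
  show ?thesis
  proof (rule ex1I[of _ "c + t *s cvec (ell K l)"], intro conjI)
    show "(c + t *s cvec (ell K l)) $ i = of_int b"
      using elli by (simp add: t_def)
    show "?f (c + t *s cvec (ell K l)) = \<beta>"
      by (simp only: add scale rel0 c) simp
  next
    fix v assume v: "v $ i = of_int b \<and> ?f v = \<beta>"
    have "?f (v - (c + t *s cvec (ell K l))) = 0"
      by (simp only: diff add scale rel0 c v) simp
    moreover have "(v - (c + t *s cvec (ell K l))) $ i = 0"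
      using elli v by (simp add: t_def)
    ultimately show "v = c + t *s cvec (ell K l)" using inj by fastforce
  qed
qed

definition E_set :: "('n::finite \<Rightarrow> int^'d) \<Rightarrow> 'n set \<Rightarrow> ('n \<Rightarrow> int) \<Rightarrow> complex^'d \<Rightarrow> (complex^'n) set"
  where "E_set a K l \<beta> = {exponent a \<beta> i b | i b. i \<in> K \<and> b \<in> {0..l i - 1}}"

definition neg_ints :: "complex set" where
  "neg_ints = of_int ` {z. z < 0}"

definition E'_set :: "('n::finite \<Rightarrow> int^'d) \<Rightarrow> 'n set \<Rightarrow> ('n \<Rightarrow> int) \<Rightarrow> complex^'d \<Rightarrow> (complex^'n) set"
  where "E'_set a K l \<beta> = {v \<in> E_set a K l \<beta>. \<forall>i\<in>K. v $ i \<notin> neg_ints}"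

definition M_set :: "'n::finite set \<Rightarrow> complex^'n \<Rightarrow> 'n set" where
  "M_set K v = {i \<in> K. v $ i \<in> \<nat>}"

definition nsupp :: "'n::finite set \<Rightarrow> complex^'n \<Rightarrow> 'n set" where
  "nsupp I w = {i \<in> I. w $ i \<in> neg_ints}"

definition minimal_nsupp :: "('n::finite \<Rightarrow> int^'d) \<Rightarrow> complex^'n \<Rightarrow> 'n set \<Rightarrow> int^'d \<Rightarrow> bool" where
  "minimal_nsupp a v I u \<longleftrightarrow> (\<forall>w\<in>Lset a u. \<not> nsupp I (v + cvec w) \<subset> nsupp I v)"

definition Zset :: "int^'n \<Rightarrow> complex^'n \<Rightarrow> 'n::finite set \<Rightarrow> int^'n \<Rightarrow> int set" where
  "Zset el v I lu = {z. nsupp I (v + cvec (lu + z *s el)) = nsupp I v}"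


subsection \<open>Formal series with logarithms and the hypergeometric system\<close>

text \<open>
  \<open>F w r\<close> is the coefficient of \<open>x\<^sup>w log\<^sup>r x\<^sub>0\<close>, with \<open>x\<^sub>0 = x\<^sup>\<ell>\<close> and \<open>\<ell>\<close> the argument \<open>el\<close> below.
\<close>

type_synonym 'n log_series = "complex^'n \<Rightarrow> nat \<Rightarrow> complex"

text \<open>
  Termwise action of the i-th partial derivative. Since \<open>log x\<^sub>0 = \<Sum>\<^sub>j \<ell>\<^sub>j log x\<^sub>j\<close> (signed \<open>\<ell>\<^sub>j\<close>),
  it sends \<open>x\<^sup>w log\<^sup>r x\<^sub>0\<close> to \<open>w\<^sub>i x\<^sup>w\<^sup>-\<^sup>e log\<^sup>r x\<^sub>0 + r \<ell>\<^sub>i x\<^sup>w\<^sup>-\<^sup>e log\<^sup>r\<^sup>-\<^sup>1 x\<^sub>0\<close>, where e is the i-th unit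
  vector.
\<close>

definition pd :: "int^'n \<Rightarrow> 'n::finite \<Rightarrow> 'n log_series \<Rightarrow> 'n log_series" where
  "pd el i F = (\<lambda>w r. (w $ i + 1) * F (w + axis i 1) r
       + of_nat (r + 1) * of_int (el $ i) * F (w + axis i 1) (r + 1))"

definition mult_monom :: "complex^'n \<Rightarrow> 'n::finite log_series \<Rightarrow> 'n log_series" where
  "mult_monom w0 F = (\<lambda>w r. F (w - w0) r)"

definition mult_log :: "nat \<Rightarrow> 'n::finite log_series \<Rightarrow> 'n log_series" where
  "mult_log q F = (\<lambda>w r. if q \<le> r then F w (r - q) else 0)"

lemma pd_commute: "pd el i (pd el j F) = pd el j (pd el i F)"
  by (auto simp: pd_def fun_eq_iff axis_def algebra_simps)

definition pd_monom :: "int^'n \<Rightarrow> ('n::finite \<Rightarrow> nat) \<Rightarrow> 'n log_series \<Rightarrow> 'n log_series" where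
  "pd_monom el m F = Finite_Set.fold (\<lambda>i. pd el i ^^ m i) F UNIV"

lemma pd_pow_commute: "comp_fun_commute (\<lambda>i. pd el i ^^ m i)"
proof
  have c1: "pd el i ((pd el j ^^ q) F) = (pd el j ^^ q) (pd el i F)" for i j q F
    by (induction q) (simp, simp, metis pd_commute)
  have "(pd el i ^^ p) ((pd el j ^^ q) F) = (pd el j ^^ q) ((pd el i ^^ p) F)" for i j p q F
    by (induction p) (auto simp: c1)
  then show "(pd el j ^^ m j) \<circ> (pd el i ^^ m i) = (pd el i ^^ m i) \<circ> (pd el j ^^ m j)" for i j
    by (auto simp: fun_eq_iff)
qed

text \<open>\<open>nat\<close> sends negative integers to 0, so only \<open>w\<^sub>j > 0\<close> resp. \<open>w\<^sub>j < 0\<close> contribute.\<close>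

definition box_op :: "int^'n \<Rightarrow> int^'n \<Rightarrow> 'n::finite log_series \<Rightarrow> 'n log_series" where
  "box_op el w F =
     (\<lambda>e r. pd_monom el (\<lambda>j. nat (w $ j)) F e r - pd_monom el (\<lambda>j. nat (- w $ j)) F e r)"

definition euler_op ::
    "int^'n \<Rightarrow> ('n::finite \<Rightarrow> int^'d) \<Rightarrow> complex^'d \<Rightarrow> 'd \<Rightarrow> 'n log_series \<Rightarrow> 'n log_series" where
  "euler_op el a \<gamma> i F =
     (\<lambda>e r. (\<Sum>j\<in>UNIV. of_int (a j $ i) * mult_monom (axis j 1) (pd el j F) e r) - \<gamma> $ i * F e r)"

definition is_solution ::
    "int^'n \<Rightarrow> ('n::finite \<Rightarrow> int^'d) \<Rightarrow> complex^'d \<Rightarrow> 'n log_series \<Rightarrow> bool" where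
  "is_solution el a \<gamma> F \<longleftrightarrow>
     (\<forall>w\<in>range (\<lambda>z. z *s el). box_op el w F = (\<lambda>e r. 0)) \<and>
     (\<forall>i. euler_op el a \<gamma> i F = (\<lambda>e r. 0))"

text \<open>
  \<open>fps_x0 el f w0 s\<close> is \<open>f(x\<^sub>0) x\<^bsup>w0\<^esup> log\<^sup>s x\<^sub>0\<close>. For \<open>el \<noteq> 0\<close> at most one index q contributes to
  the sum.
\<close>

definition fps_x0 :: "int^'n \<Rightarrow> complex fps \<Rightarrow> complex^'n \<Rightarrow> nat \<Rightarrow> 'n::finite log_series" where
  "fps_x0 el f w0 s =
     (\<lambda>w r. if r = s then \<Sum>q | w = w0 + of_nat q *s cvec el. fps_nth f q else 0)"

text \<open>\<open>\<complex>[[x\<^sub>0]][x\<^sub>0\<^sup>-\<^sup>1, log x\<^sub>0, x\<^sup>v]\<close>: polynomial expressions with coefficients \<open>f p s m\<close>.\<close>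

definition nilsson_ring :: "int^'n \<Rightarrow> complex^'n \<Rightarrow> 'n::finite log_series set" where
  "nilsson_ring el v = {F. \<exists>(N::nat) (f :: nat \<Rightarrow> nat \<Rightarrow> nat \<Rightarrow> complex fps).
     F = (\<lambda>w r. \<Sum>p\<le>N. \<Sum>s\<le>N. \<Sum>m\<le>N.
            fps_x0 el (f p s m) (of_nat m *s v - of_nat p *s cvec el) s w r)}"


subsection \<open>The series\<close>

definition elem_sym :: "nat \<Rightarrow> nat \<Rightarrow> (nat \<Rightarrow> complex) \<Rightarrow> complex" where
  "elem_sym \<sigma> \<tau> y = (\<Sum>T | T \<subseteq> {..<\<sigma>} \<and> card T = \<tau>. \<Prod>t\<in>T. y t)"

text \<open>
  For \<open>l > 0\<close> the formula is meant for c, l such that none of \<open>c + 1, \<dots>, c + l\<close> vanishes. Under the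
  minimality assumption of the theorem no other values are used.
\<close>

definition Mc :: "int \<Rightarrow> nat \<Rightarrow> complex \<Rightarrow> complex" where
  "Mc l s c =
     (if l = 0 then (if s = 0 then 1 else 0)
      else if l > 0 then
        (- 1) ^ s / (\<Prod>m\<in>{1..nat l}. c + of_nat m) *
        (\<Sum>i | i \<in> {1..nat l} \<rightarrow>\<^sub>E UNIV \<and> (\<Sum>m\<in>{1..nat l}. i m) = s.
           \<Prod>m\<in>{1..nat l}. 1 / (c + of_nat m) ^ i m)
      else if s \<le> nat (- l) then elem_sym (nat (- l)) (nat (- l) - s) (\<lambda>t. c - of_nat t)
      else 0)"

text \<open>
  \<open>Phi\<close> is the log-free series \<open>\<Phi>\<^sup>Q\<close>. The multiplicity of i in Q is \<open>count_list Q i\<close>, and \<open>lu\<close>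
  stands for \<open>\<ell>\<^sup>(\<^sup>u\<^sup>)\<close>, an integer vector with \<open>lu \<in> Lset a u\<close>. For \<open>ell K l \<noteq> 0\<close> at most one z contributes to each coefficient.

  The factor \<open>fact (count_list Q i)\<close> is needed when an index is repeated in Q: the coefficient of
  \<open>log\<^sup>m\<^sup>-\<^sup>s x\<close> in the term obtained from \<open>x\<^sup>c log\<^sup>m x\<close> by -l-fold differentiation (l < 0) or l-fold
  integration (l > 0) is \<open>(m choose s) * fact s * Mc l s c\<close>, and the \<open>(m choose s)\<close> is accounted
  for by the choice of positions in \<open>S_series\<close>. Without the factor \<open>S_series\<close> fails to be a
  solution, e.g. for \<open>\<ell> = (1, 1, 1)\<close>, v = 0, u = 0, r = 2.
\<close>

definition Phi ::
    "'n set \<Rightarrow> ('n \<Rightarrow> int) \<Rightarrow> complex^'n \<Rightarrow> int^'n \<Rightarrow> 'n list \<Rightarrow> 'n::finite log_series" where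
  "Phi K l v lu Q = (\<lambda>w r. if r = 0 then
     \<Sum>z | z \<in> Zset (ell K l) v (- set Q) lu \<and> w = v + cvec (lu + z *s ell K l).
       (\<Prod>i\<in>K. fact (count_list Q i) * Mc (lu $ i + z * l i) (count_list Q i) (v $ i)) *
       (\<Prod>j\<in>- K. fact (count_list Q j) * Mc (lu $ j - z * l j) (count_list Q j) (v $ j))
     else 0)"

text \<open>
  A choice \<open>t\<^sub>1 < \<dots> < t\<^sub>s\<close> in \<open>{1..r}\<close> is a subset T of cardinality s, and the indices
  \<open>p\<^sub>t\<close> form a function on T.
\<close>

definition S_series ::
    "'n set \<Rightarrow> ('n \<Rightarrow> int) \<Rightarrow> complex^'n \<Rightarrow> int^'n \<Rightarrow> nat \<Rightarrow> 'n::finite log_series" where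
  "S_series K l v lu r = (\<lambda>w q.
     \<Sum>s\<in>{0..r}. \<Sum>T | T \<subseteq> {1..r} \<and> card T = s. \<Sum>p\<in>T \<rightarrow>\<^sub>E UNIV.
       (\<Prod>t\<in>T. of_int (sgn_coeff K (p t) * l (p t))) *
       mult_log (r - s) (Phi K l v lu (map p (sorted_list_of_set T))) w q)"

end

theory Submission
  imports Defs
begin

text \<open>
Let t be a formal variable and put
\<open>G(m, c; t) = \<Gamma>(c + t + 1) / \<Gamma>(c + m + t + 1)\<close>, a rational function of t for every integer m.
If it has no pole at t = 0, its Taylor coefficients there are the constants \<open>M\<^bsub>m,s\<^esub>(c)\<close>. The sum over
sequences Q that defines the series S is a Leibniz rule in disguise: S is r! times the coefficient
of \<open>t\<^sup>r\<close> in the deformed hypergeometric series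

\<open>\<Sum>\<^sub>z x\<^bsup>v + lu + z \<ell>\<^esup> x\<^sub>0\<^sup>t \<Prod>\<^sub>i G(lu\<^sub>i + z \<ell>\<^sub>i, v\<^sub>i; \<ell>\<^sub>i t)\<close>,

where \<open>\<ell>\<^sub>i\<close> are the signed coefficients and G is read as 0 if it has a pole
(\<open>S_series_eq_log_poly\<close>). This is the method of Frobenius: the recurrence
\<open>(c + m + t) G(m, c; t) = G(m - 1, c; t)\<close> says that differentiation moves along the coefficients, so
both monomials of a box operator send the deformed series to the same series.

The point that needs care is the behaviour of G at t = 0. If c is a negative integer and c + m is
not, then G has a pole; the convention 1/0 = 0 makes the constants \<open>M\<^bsub>m,s\<^esub>(c)\<close> vanish, and the
recurrence can fail. If c is not a negative integer and c + m is one, then G has a simple zero.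
Minimality of the negative support plays the zeros off against the poles: applied to the complement I of
the set of indices with a zero, it says that a lattice point with a pole has more than r zeros, since
otherwise \<open>|I| \<ge> n - r\<close> and the I-negative support would be strictly smaller there than at v
(\<open>card_new_negatives_at_pole\<close>). Differentiation lowers the exponents and so preserves the zeros. Hence
the coefficient that the recurrence predicts after differentiating at such a point is divisible by
\<open>t\<^bsup>r + 1\<^esup>\<close> and agrees, up to the order that matters, with the 0 that the convention produces
(\<open>pd_factor_gamma_coeff\<close>). Minimality also explains the restriction of z in the series \<open>\<Phi>\<^sup>Q\<close>: a z that
it excludes has a zero at an index outside Q, so the corresponding term would be 0 anyway
(\<open>Phi_lattice_point\<close>).

The Euler operators only see the exponents, which all satisfy \<open>\<Sum>\<^sub>j w\<^sub>j a\<^sub>j = \<beta> + u\<close>. Finally, for z far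
below 0 there is a zero at every index in \<open>M\<^sub>v\<close>; as \<open>m\<^sub>v > r\<close>, the coefficients of order at most r in t
vanish there, so the powers of \<open>x\<^sub>0\<close> are bounded below and the series lies in the Nilsson ring.
\<close>


section \<open>Gamma quotients and their Taylor coefficients\<close>

text \<open>
The Taylor series of \<open>\<Gamma>(c + t + 1) / \<Gamma>(c + l + t + 1)\<close> at t = 0, and 0 if there is a pole at t = 0.
\<close>

definition gamma_quot :: "int \<Rightarrow> complex \<Rightarrow> complex fps" where
  "gamma_quot l c = Abs_fps (\<lambda>s. Mc l s c)"

lemma fps_const_prod: "fps_const (prod f A) = (\<Prod>x\<in>A. fps_const (f x))"
  by (induction A rule: infinite_finite_induct) (auto simp flip: fps_const_mult)

lemma fps_nth_prod_linear:
  fixes y :: "nat \<Rightarrow> complex"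
  shows "fps_nth (\<Prod>k<\<sigma>. fps_const (y k) + fps_X) s = (if s \<le> \<sigma> then elem_sym \<sigma> (\<sigma> - s) y else 0)"
proof -
  have "(\<Prod>k<\<sigma>. fps_const (y k) + fps_X) =
      (\<Sum>T\<in>Pow {..<\<sigma>}. fps_const (prod y T) * fps_X ^ (\<sigma> - card T))"
    by (subst prod_add) (auto intro!: sum.cong simp: card_Diff_subset finite_subset fps_const_prod)
  then have "fps_nth (\<Prod>k<\<sigma>. fps_const (y k) + fps_X) s =
      (\<Sum>T\<in>Pow {..<\<sigma>}. if s = \<sigma> - card T then prod y T else 0)"
    by (simp add: fps_sum_nth if_distrib cong: if_cong)
  also have "\<dots> = (\<Sum>T | T \<in> Pow {..<\<sigma>} \<and> s = \<sigma> - card T. prod y T)"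
    by (rule sum.inter_filter[symmetric]) simp
  also have "{T. T \<in> Pow {..<\<sigma>} \<and> s = \<sigma> - card T} =
      (if s \<le> \<sigma> then {T. T \<subseteq> {..<\<sigma>} \<and> card T = \<sigma> - s} else {})"
    using card_mono[of "{..<\<sigma>}"] by (auto simp: Pow_def)
  finally show ?thesis
    by (simp add: elem_sym_def)
qed

lemma elem_sym_0: "elem_sym 0 0 y = 1"
proof -
  have "{T. T \<subseteq> {..<0::nat} \<and> card T = 0} = {{}}"
    by auto
  then show ?thesis
    by (simp add: elem_sym_def)
qed

lemma gamma_quot_nonpos:
  assumes "l \<le> 0"
  shows "gamma_quot l c = (\<Prod>k<nat (- l). fps_const (c - of_nat k) + fps_X)"
  using assms by (auto simp: fps_eq_iff gamma_quot_def Mc_def fps_nth_prod_linear elem_sym_0)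

text \<open>
The Cauchy product of several series is a sum over multisets; the exponents i are the
multiplicity functions of these multisets.
\<close>

lemma fps_nth_prod_geometric:
  fixes y :: "'a \<Rightarrow> 'b :: comm_ring_1"
  assumes A: "finite A"
  shows "fps_nth (\<Prod>m\<in>A. Abs_fps (\<lambda>k. y m ^ k)) s =
    (\<Sum>i | i \<in> A \<rightarrow>\<^sub>E UNIV \<and> (\<Sum>m\<in>A. i m) = s. \<Prod>m\<in>A. y m ^ i m)"
proof -
  let ?ms = "\<lambda>i. \<Sum>m\<in>A. replicate_mset (i m) m"
  have count: "count (?ms i) x = (if x \<in> A then i x else 0)" for i :: "'a \<Rightarrow> nat" and x
    using A by (simp add: count_sum)
  have supp: "set_mset (?ms i) \<subseteq> A" for i :: "'a \<Rightarrow> nat"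
  proof (rule subsetI, rule ccontr)
    fix x assume "x \<in># ?ms i" "x \<notin> A"
    then show False
      using count[of i x] by (simp only: if_False count_eq_zero_iff not_True_eq_False)
  qed
  have size: "size X = (\<Sum>m\<in>A. count X m)" if "set_mset X \<subseteq> A" for X
    unfolding size_multiset_overloaded_eq
    using that A by (intro sum.mono_neutral_left) (auto simp: count_eq_zero_iff)
  have "fps_nth (\<Prod>m\<in>A. Abs_fps (\<lambda>k. y m ^ k)) s =
      (\<Sum>X\<in>multisets_of_size A s. \<Prod>m\<in>A. y m ^ count X m)"
    using A by (simp add: fps_prod_nth')
  also have "\<dots> = (\<Sum>i | i \<in> A \<rightarrow>\<^sub>E UNIV \<and> (\<Sum>m\<in>A. i m) = s. \<Prod>m\<in>A. y m ^ i m)"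
  proof (rule sum.reindex_bij_witness[of _ ?ms "\<lambda>X. restrict (count X) A"])
    fix X assume X: "X \<in> multisets_of_size A s"
    then have "set_mset X \<subseteq> A"
      by (simp add: multisets_of_size_def)
    then have "count X m = 0" if "m \<notin> A" for m
      using that by (meson count_eq_zero_iff subsetD)
    then show "?ms (restrict (count X) A) = X"
      by (intro multiset_eqI) (auto simp: count)
    show "restrict (count X) A \<in> {i. i \<in> A \<rightarrow>\<^sub>E UNIV \<and> (\<Sum>m\<in>A. i m) = s}"
      using X size[of X] by (auto simp: multisets_of_size_def)
  next
    fix i assume i: "i \<in> {i. i \<in> A \<rightarrow>\<^sub>E UNIV \<and> (\<Sum>m\<in>A. i m) = s}"
    show "restrict (count (?ms i)) A = i"
      using i by (auto simp: fun_eq_iff count PiE_def extensional_def)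
    show "?ms i \<in> multisets_of_size A s"
      using i supp[of i] size[OF supp[of i]] by (simp add: multisets_of_size_def count)
  qed auto
  finally show ?thesis .
qed

text \<open>
The complete homogeneous sum in \<open>M\<^bsub>l,s\<^esub>(c)\<close> comes from expanding each factor
\<open>1 / (c + m + t)\<close> as a geometric series in \<open>- t / (c + m)\<close>.
\<close>

lemma gamma_quot_pos:
  assumes l: "l > 0" and nz: "\<And>m. m \<in> {1..nat l} \<Longrightarrow> c + of_nat m \<noteq> 0"
  shows "gamma_quot l c * (\<Prod>m\<in>{1..nat l}. fps_const (c + of_nat m) + fps_X) = 1"
proof -
  let ?A = "{1..nat l}"
  let ?P = "\<Prod>m\<in>?A. c + of_nat m"
  let ?geo = "\<lambda>m::nat. Abs_fps (\<lambda>k. (- (1 / (c + of_nat m))) ^ k)"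
  have "gamma_quot l c = fps_const (1 / ?P) * (\<Prod>m\<in>?A. ?geo m)"
  proof (rule fps_ext)
    fix s
    have "fps_nth (\<Prod>m\<in>?A. ?geo m) s =
       (\<Sum>i | i \<in> ?A \<rightarrow>\<^sub>E UNIV \<and> (\<Sum>m\<in>?A. i m) = s. (- 1) ^ s * (\<Prod>m\<in>?A. 1 / (c + of_nat m) ^ i m))"
      by (subst fps_nth_prod_geometric)
        (auto intro!: sum.cong simp: power_minus[of "1 / _"] prod.distrib power_sum power_one_over
          simp flip: prod.distrib)
    then show "fps_nth (gamma_quot l c) s = fps_nth (fps_const (1 / ?P) * (\<Prod>m\<in>?A. ?geo m)) s"
      using l by (simp add: gamma_quot_def Mc_def sum_distrib_left)
  qed
  moreover have "?geo m * (fps_const (c + of_nat m) + fps_X) = fps_const (c + of_nat m)" if "m \<in> ?A" for m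
  proof (rule fps_ext)
    fix n
    show "fps_nth (?geo m * (fps_const (c + of_nat m) + fps_X)) n = fps_nth (fps_const (c + of_nat m)) n"
    proof (cases n)
      case (Suc k)
      have "(- (1 / x)) ^ Suc k * x + (- (1 / x)) ^ k = 0" if "x \<noteq> 0" for x :: complex
        using that by simp
      then show ?thesis
        using nz[OF that] Suc by (simp add: distrib_left[of "Abs_fps _"] del: power_Suc of_nat_Suc)
    qed (use nz[OF that] in \<open>simp add: distrib_left\<close>)
  qed
  then have "(\<Prod>m\<in>?A. ?geo m) * (\<Prod>m\<in>?A. fps_const (c + of_nat m) + fps_X) = fps_const ?P"
    by (simp add: fps_const_prod flip: prod.distrib)
  ultimately have "gamma_quot l c * (\<Prod>m\<in>?A. fps_const (c + of_nat m) + fps_X) = fps_const (1 / ?P) * fps_const ?P"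
    by (simp only: mult.assoc)
  moreover have "?P \<noteq> 0"
    using nz by auto
  ultimately show ?thesis
    by simp
qed

lemma of_int_neg_ints [simp]: "of_int z \<in> neg_ints \<longleftrightarrow> z < 0"
  by (simp add: neg_ints_def image_iff)

lemma neg_intsE:
  assumes "c \<in> neg_ints"
  obtains z where "z < 0" "c = of_int z"
  using assms unfolding neg_ints_def by blast

text \<open>
Translates the vanishing of a denominator into the language of negative supports, in which
minimality is stated.
\<close>

lemma pole_iff:
  "c \<in> neg_ints \<and> c + of_int l \<notin> neg_ints \<longleftrightarrow> (\<exists>m\<in>{1..nat l}. c + of_nat m = 0)"
proof (intro iffI; (elim conjE bexE)?)
  assume "c \<in> neg_ints" and l: "c + of_int l \<notin> neg_ints"
  then obtain z where z: "z < 0" "c = of_int z"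
    by (elim neg_intsE)
  have "\<not> z + l < 0"
    using l unfolding z(2) of_int_add[symmetric] of_int_neg_ints .
  moreover have "c + of_nat (nat (- z)) = 0"
    using z(1) by (simp add: z(2))
  ultimately show "\<exists>m\<in>{1..nat l}. c + of_nat m = 0"
    using z(1) by (intro bexI[of _ "nat (- z)"]) auto
next
  fix m assume m: "m \<in> {1..nat l}" "c + of_nat m = 0"
  have c: "c = of_int (- int m)"
    using m(2) by (simp add: eq_neg_iff_add_eq_0)
  show "c \<in> neg_ints \<and> c + of_int l \<notin> neg_ints"
    unfolding c of_int_add[symmetric] of_int_neg_ints using m(1) by auto
qed

lemma gamma_quot_pole:
  assumes "c \<in> neg_ints" "c + of_int l \<notin> neg_ints"
  shows "gamma_quot l c = 0"
proof -
  from assms obtain m where m: "m \<in> {1..nat l}" "c + of_nat m = 0"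
    using pole_iff by blast
  \<comment> \<open>The constants have this product as their denominator, and division by 0 gives 0.\<close>
  have "(\<Prod>m\<in>{1..nat l}. c + of_nat m) = 0"
    by (rule prod_zero) (use m in blast)+
  moreover have "l > 0"
    using m(1) by auto
  ultimately show ?thesis
    by (simp add: gamma_quot_def Mc_def fps_eq_iff)
qed

text \<open>
The functional equation \<open>\<Gamma>(c + l + t + 1) = (c + l + t) \<Gamma>(c + l + t)\<close>. At a pole it can
fail, because the left-hand side is 0 by convention.
\<close>

lemma gamma_quot_step:
  assumes nopole: "\<not> (c \<in> neg_ints \<and> c + of_int l \<notin> neg_ints)"
  shows "(fps_const (c + of_int l) + fps_X) * gamma_quot l c = gamma_quot (l - 1) c"
proof (cases "l \<le> 0")
  case True
  then have "nat (- (l - 1)) = Suc (nat (- l))" "complex_of_int l = - of_nat (nat (- l))"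
    by auto
  then show ?thesis
    using True by (simp add: gamma_quot_nonpos mult.commute)
next
  case False
  then obtain n where n: "l = int (Suc n)"
    by (intro that[of "nat l - 1"]) auto
  have nz: "c + of_nat m \<noteq> 0" if "m \<in> {1..Suc n}" for m
    using nopole that unfolding pole_iff n by auto
  let ?P = "\<lambda>n. \<Prod>m\<in>{1..n}. fps_const (c + of_nat m) + fps_X"
  have 1: "gamma_quot l c * (?P n * (fps_const (c + of_int l) + fps_X)) = 1"
    using gamma_quot_pos[of l c] nz unfolding n nat_int of_int_of_nat_eq by (simp add: prod.cl_ivl_Suc)
  have 2: "gamma_quot (l - 1) c * ?P n = 1"
    using gamma_quot_pos[of "l - 1" c] nz n gamma_quot_nonpos[of 0 c] by (cases "n = 0") auto
  let ?f = "fps_const (c + of_int l) + fps_X"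
  have "?f * gamma_quot l c = (gamma_quot (l - 1) c * ?P n) * (?f * gamma_quot l c)"
    by (simp only: 2 mult_1_left)
  also have "\<dots> = gamma_quot (l - 1) c * (gamma_quot l c * (?P n * ?f))"
    by (simp only: mult_ac)
  finally show ?thesis
    by (simp only: 1 mult_1_right)
qed

lemma fps_prod_nth_0:
  fixes f :: "'a \<Rightarrow> 'b :: comm_ring_1 fps"
  shows "fps_nth (\<Prod>x\<in>A. f x) 0 = (\<Prod>x\<in>A. fps_nth (f x) 0)"
  by (induction A rule: infinite_finite_induct) auto

text \<open>
Here \<open>c\<close> has to be a nonnegative integer smaller than -l, so c is one of the numbers k that give a
factor \<open>c - k + t\<close>.
\<close>

lemma gamma_quot_new_negative:
  assumes "c \<notin> neg_ints" "c + of_int l \<in> neg_ints"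
  shows "fps_nth (gamma_quot l c) 0 = 0"
proof -
  obtain z where z: "z < 0" "c + of_int l = of_int z"
    using assms(2) by (elim neg_intsE)
  have c: "c = of_int (z - l)"
    unfolding of_int_diff eq_diff_eq by (rule z(2))
  have "z - l \<ge> 0"
    using assms(1) unfolding c of_int_neg_ints by simp
  then have "nat (z - l) < nat (- l)" "l \<le> 0" "c - of_nat (nat (z - l)) = 0"
    using z(1) by (simp_all add: c)
  then have "fps_nth (\<Prod>k<nat (- l). fps_const (c - of_nat k) + fps_X) 0 = 0"
    unfolding fps_prod_nth_0 by (intro prod_zero) auto
  then show ?thesis
    using \<open>l \<le> 0\<close> by (simp add: gamma_quot_nonpos)
qed


section \<open>Higher derivatives of a finite product\<close>

lemma fps_deriv_prod:
  fixes f :: "'a \<Rightarrow> 'b :: comm_ring_1 fps"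
  assumes "finite I"
  shows "fps_deriv (\<Prod>i\<in>I. f i) = (\<Sum>j\<in>I. \<Prod>i\<in>I. if i = j then fps_deriv (f i) else f i)"
  using assms
proof (induction I rule: finite_induct)
  case (insert x I)
  have "(\<Prod>i\<in>insert x I. if i = j then fps_deriv (f i) else f i) =
      f x * (\<Prod>i\<in>I. if i = j then fps_deriv (f i) else f i)" if "j \<in> I" for j
    using insert that by (subst prod.insert) auto
  moreover have "(\<Prod>i\<in>insert x I. if i = x then fps_deriv (f i) else f i) =
      fps_deriv (f x) * (\<Prod>i\<in>I. f i)"
  proof -
    have "(\<Prod>i\<in>I. if i = x then fps_deriv (f i) else f i) = (\<Prod>i\<in>I. f i)"
      using insert.hyps by (intro prod.cong) auto
    then show ?thesis
      using insert.hyps by simp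
  qed
  ultimately show ?case
    using insert by (simp add: sum_distrib_left)
qed simp

text \<open>
The Leibniz rule in ordered form: each element t of T stands for one differentiation, and \<open>p t\<close> is
the factor it hits. In this form the induction step needs no binomial coefficients, and the functions
p are those over which the series \<open>S\<close> is summed.
\<close>

lemma fps_nth_deriv_prod:
  fixes f :: "'a \<Rightarrow> 'b :: comm_ring_1 fps"
  assumes "finite I" and "finite T"
  shows "fps_nth_deriv (card T) (\<Prod>i\<in>I. f i) =
    (\<Sum>p\<in>T \<rightarrow>\<^sub>E I. \<Prod>i\<in>I. fps_nth_deriv (card {t\<in>T. p t = i}) (f i))"
  using assms(2)
proof (induction T rule: finite_induct)
  case (insert x T)
  let ?D = "\<lambda>p i. fps_nth_deriv (card {t\<in>T. p t = i}) (f i)"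
  have step: "fps_nth_deriv (card {t\<in>insert x T. (p(x := j)) t = i}) (f i) =
      (if i = j then fps_deriv (?D p i) else ?D p i)" for p i j
  proof -
    have "{t\<in>insert x T. (p(x := j)) t = i} =
        (if i = j then insert x {t\<in>T. p t = i} else {t\<in>T. p t = i})"
      using insert.hyps by auto
    then show ?thesis
      using insert.hyps by (simp add: fps_nth_deriv_commute del: fps_nth_deriv.simps)
  qed
  have "(\<Sum>p\<in>insert x T \<rightarrow>\<^sub>E I. \<Prod>i\<in>I. fps_nth_deriv (card {t\<in>insert x T. p t = i}) (f i)) =
      (\<Sum>(j, p)\<in>I \<times> (T \<rightarrow>\<^sub>E I).
        \<Prod>i\<in>I. fps_nth_deriv (card {t\<in>insert x T. (p(x := j)) t = i}) (f i))"
    unfolding PiE_insert_eq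
    by (subst sum.reindex[OF inj_combinator[OF insert.hyps(2)]]) (simp add: case_prod_unfold o_def)
  also have "\<dots> = (\<Sum>p\<in>T \<rightarrow>\<^sub>E I. \<Sum>j\<in>I. \<Prod>i\<in>I. if i = j then fps_deriv (?D p i) else ?D p i)"
    unfolding step sum.cartesian_product[symmetric] by (rule sum.swap)
  also have "\<dots> = (\<Sum>p\<in>T \<rightarrow>\<^sub>E I. fps_deriv (\<Prod>i\<in>I. ?D p i))"
    using assms(1) by (simp add: fps_deriv_prod)
  also have "\<dots> = fps_deriv (fps_nth_deriv (card T) (\<Prod>i\<in>I. f i))"
    unfolding insert.IH by (rule fps_deriv_sum[symmetric])
  finally show ?case
    using insert.hyps by (simp add: fps_nth_deriv_commute del: fps_nth_deriv.simps)
qed simp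

text \<open>
The value of the Leibniz rule at 0. It turns a sum over all choices of indices, weighted by
factorials of multiplicities, into a coefficient of a product.
\<close>

lemma fps_nth_prod_multinomial:
  fixes f :: "'a \<Rightarrow> 'b :: {comm_ring_1, semiring_char_0} fps"
  assumes "finite I" and "finite T"
  shows "(\<Sum>p\<in>T \<rightarrow>\<^sub>E I. \<Prod>i\<in>I. fact (card {t\<in>T. p t = i}) * fps_nth (f i) (card {t\<in>T. p t = i})) =
    fact (card T) * fps_nth (\<Prod>i\<in>I. f i) (card T)"
proof -
  have "fact (card T) * fps_nth (\<Prod>i\<in>I. f i) (card T) =
      fps_nth (fps_nth_deriv (card T) (\<Prod>i\<in>I. f i)) 0"
    by (simp add: fps_deriv_maclauren_0)
  also have "\<dots> = (\<Sum>p\<in>T \<rightarrow>\<^sub>E I. \<Prod>i\<in>I. fps_nth (fps_nth_deriv (card {t\<in>T. p t = i}) (f i)) 0)"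
    by (simp add: fps_nth_deriv_prod[OF assms] fps_sum_nth fps_prod_nth_0)
  finally show ?thesis
    by (simp add: fps_deriv_maclauren_0)
qed

section \<open>Logarithmic series as Taylor coefficients of deformed series\<close>

text \<open>
This is r! times the coefficient of \<open>t\<^sup>r\<close> in \<open>\<Sum>\<^sub>w C\<^sub>w(t) x\<^sup>w x\<^sub>0\<^sup>t\<close>, because \<open>x\<^sub>0\<^sup>t = \<Sum>\<^sub>q t\<^sup>q log\<^sup>q x\<^sub>0 / q!\<close>.
\<close>

definition log_poly :: "nat \<Rightarrow> (complex^'n \<Rightarrow> complex fps) \<Rightarrow> 'n::finite log_series" where
  "log_poly r C = (\<lambda>w q. if q \<le> r then fact r / fact q * fps_nth (C w) (r - q) else 0)"

text \<open>
The factor by which \<open>\<partial>\<^sub>i\<^sup>m\<close> multiplies \<open>x\<^sup>w x\<^sub>0\<^sup>t\<close> when c is the exponent of \<open>x\<^sub>i\<close> after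
differentiation, that is \<open>w\<^sub>i = c + m\<close>. On \<open>x\<^sub>0\<^sup>t\<close> the exponent of \<open>x\<^sub>i\<close> is \<open>\<ell>\<^sub>i t\<close>.
\<close>

definition pd_factor :: "int^'n \<Rightarrow> 'n::finite \<Rightarrow> nat \<Rightarrow> complex \<Rightarrow> complex fps" where
  "pd_factor el i m c = (\<Prod>k<m. fps_const (c + of_nat (k + 1)) + fps_const (of_int (el $ i)) * fps_X)"

text \<open>
The two terms of a derivative of \<open>x\<^sup>w log\<^sup>q x\<^sub>0\<close> become a single multiplication by \<open>w\<^sub>i + \<ell>\<^sub>i t\<close> on the
level of deformed series, where \<open>x\<^sup>w x\<^sub>0\<^sup>t\<close> is an honest monomial.
\<close>

lemma pd_log_poly:
  "pd el i (log_poly r C) = log_poly r (\<lambda>w. pd_factor el i 1 (w $ i) * C (w + axis i 1))"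
proof (intro ext)
  fix w q
  let ?D = "C (w + axis i 1)"
  let ?a = "w $ i + 1" and ?b = "of_int (el $ i) :: complex"
  have nth: "fps_nth (pd_factor el i 1 (w $ i) * ?D) s =
      ?a * fps_nth ?D s + (if s = 0 then 0 else ?b * fps_nth ?D (s - 1))" for s
    by (simp add: pd_factor_def distrib_right mult.assoc)
  consider "q < r" | "q = r" | "q > r"
    by linarith
  then show "pd el i (log_poly r C) w q =
      log_poly r (\<lambda>w. pd_factor el i 1 (w $ i) * C (w + axis i 1)) w q"
  proof cases
    case 1
    then have "r - q - 1 = r - (q + 1)" "r - q \<noteq> 0"
      by auto
    moreover have "of_nat (q + 1) * ?b * (fact r / fact (q + 1) * y) = fact r / fact q * (?b * y)" for y
      by (simp add: of_nat_neq_0 del: of_nat_Suc)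
    moreover have "q \<le> r" "q + 1 \<le> r"
      using 1 by auto
    ultimately show ?thesis
      unfolding pd_def log_poly_def nth by (simp only: if_True if_False distrib_left mult.left_commute)
  qed (simp_all add: pd_def log_poly_def nth del: One_nat_def fps_mult_nth_0)
qed

lemma pd_pow_log_poly:
  "(pd el i ^^ m) (log_poly r C) = log_poly r (\<lambda>w. pd_factor el i m (w $ i) * C (w + axis i (of_nat m)))"
proof (induction m)
  case 0
  then show ?case
    by (simp add: pd_factor_def axis_def zero_vec_def[symmetric])
next
  case (Suc m)
  have "pd_factor el i 1 c * pd_factor el i m (c + 1) = pd_factor el i (Suc m) c" for c
    unfolding pd_factor_def prod.lessThan_Suc_shift by (simp add: algebra_simps)
  moreover have "w + axis i 1 + axis i (of_nat m) = w + axis i (of_nat (Suc m))" for w :: "complex^'a"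
    by (simp add: vec_eq_iff axis_def)
  moreover have "(w + axis i 1) $ i = w $ i + 1" for w :: "complex^'a"
    by simp
  ultimately show ?case
    by (simp only: funpow.simps o_apply Suc pd_log_poly mult.assoc[symmetric])
qed

lemma pd_monom_log_poly:
  "pd_monom el m (log_poly r C) =
     log_poly r (\<lambda>w. (\<Prod>i\<in>UNIV. pd_factor el i (m i) (w $ i)) * C (w + (\<chi> i. of_nat (m i))))"
proof -
  interpret comp_fun_commute "\<lambda>i. pd el i ^^ m i"
    by (rule pd_pow_commute)
  have "Finite_Set.fold (\<lambda>i. pd el i ^^ m i) (log_poly r C) A =
      log_poly r (\<lambda>w. (\<Prod>i\<in>A. pd_factor el i (m i) (w $ i)) *
        C (w + (\<chi> i. if i \<in> A then of_nat (m i) else 0)))" if "finite A" for A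
    using that
  proof (induction A rule: finite_induct)
    case empty
    then show ?case
      by (simp add: zero_vec_def[symmetric])
  next
    case (insert x A)
    have "(\<Prod>i\<in>A. pd_factor el i (m i) ((w + axis x c) $ i)) = (\<Prod>i\<in>A. pd_factor el i (m i) (w $ i))"
      for w c
      using insert.hyps by (intro prod.cong) (auto simp: axis_def)
    moreover have "w + axis x (of_nat (m x)) + (\<chi> i. if i \<in> A then of_nat (m i) else 0) =
        w + (\<chi> i. if i \<in> insert x A then of_nat (m i) else 0)" for w :: "complex^'a"
      using insert.hyps by (auto simp: vec_eq_iff axis_def)
    ultimately show ?case
      unfolding fold_insert[OF insert.hyps] insert.IH pd_pow_log_poly prod.insert[OF insert.hyps]
      by (simp only: mult.assoc)
  qed
  from this[of UNIV] show ?thesis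
    by (simp add: pd_monom_def)
qed


section \<open>Coefficients of the deformed hypergeometric series\<close>

definition gamma_coeff :: "int^'n \<Rightarrow> complex^'n \<Rightarrow> int^'n \<Rightarrow> complex fps" where
  "gamma_coeff el v m =
     (\<Prod>i\<in>(UNIV :: 'n::finite set). gamma_quot (m $ i) (v $ i) oo (fps_const (of_int (el $ i)) * fps_X))"

text \<open>
The indices at which the Gamma quotient in \<open>gamma_coeff el v m\<close> has a zero at t = 0.
\<close>

definition new_negatives :: "complex^'n \<Rightarrow> int^'n \<Rightarrow> 'n::finite set" where
  "new_negatives v m = {i. v $ i \<notin> neg_ints \<and> v $ i + of_int (m $ i) \<in> neg_ints}"

text \<open>
The sum has at most one term if \<open>el \<noteq> 0\<close>; it extends \<open>gamma_coeff\<close> by 0 to exponents that are not of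
the form \<open>v + lu + z el\<close>.
\<close>

definition lattice_coeff :: "int^'n \<Rightarrow> complex^'n \<Rightarrow> int^'n \<Rightarrow> complex^'n \<Rightarrow> complex fps" where
  "lattice_coeff el v lu w = (\<Sum>z | w = v + cvec (lu + z *s el). gamma_coeff el v (lu + z *s el))"

lemma fps_X_dvdI: "fps_X dvd f" if "fps_nth f 0 = 0" for f :: "'a :: comm_ring_1 fps"
proof
  show "f = fps_X * fps_shift 1 f"
    using that by (intro fps_ext) auto
qed

lemma gamma_coeff_vanish:
  assumes "s < card (new_negatives v m)"
  shows "fps_nth (gamma_coeff el v m) s = 0"
proof -
  let ?N = "new_negatives v m"
  let ?H = "\<lambda>i. gamma_quot (m $ i) (v $ i) oo (fps_const (of_int (el $ i)) * fps_X)"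
  have "fps_X dvd ?H i" if "i \<in> ?N" for i
    using that gamma_quot_new_negative by (intro fps_X_dvdI) (auto simp: fps_compose_linear new_negatives_def)
  then have "(\<Prod>i\<in>?N. fps_X) dvd (\<Prod>i\<in>?N. ?H i)"
    by (intro prod_dvd_prod)
  also have "\<dots> dvd gamma_coeff el v m"
    unfolding gamma_coeff_def by (intro prod_dvd_prod_subset) auto
  finally obtain g where "gamma_coeff el v m = fps_X ^ card ?N * g"
    by (auto simp: dvd_def)
  then show ?thesis
    using assms by (simp add: fps_X_power_mult_nth)
qed

text \<open>
Away from poles, k-fold differentiation lowers the index l by k, one step of the functional equation
at a time: no pole arises on the way, since decreasing l keeps a negative integer negative.
\<close>

lemma pd_factor_gamma_quot:
  fixes c :: complex
  assumes "\<not> (c \<in> neg_ints \<and> c + of_int l \<notin> neg_ints)"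
  shows "pd_factor el i k (c + of_int l - of_nat k) * (gamma_quot l c oo (fps_const (of_int (el $ i)) * fps_X)) =
    gamma_quot (l - int k) c oo (fps_const (of_int (el $ i)) * fps_X)"
proof (induction k)
  case 0
  then show ?case
    by (simp add: pd_factor_def)
next
  case (Suc k)
  let ?X = "fps_const (of_int (el $ i)) * fps_X :: complex fps"
  have X0: "fps_nth ?X 0 = 0"
    by simp
  \<comment> \<open>There is still no pole after k steps.\<close>
  have "c + of_int (l - int k) \<in> neg_ints" if "c \<in> neg_ints"
  proof -
    obtain y where y: "y < 0" "c + of_int l = of_int y"
      using assms \<open>c \<in> neg_ints\<close> by (elim conjE neg_intsE) (auto elim: neg_intsE)
    have "c + of_int (l - int k) = of_int (y - int k)"
      unfolding of_int_diff y(2)[symmetric] by simp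
    then show ?thesis
      using y(1) by (simp only: of_int_neg_ints)
  qed
  then have "(fps_const (c + of_int (l - int k)) + fps_X) * gamma_quot (l - int k) c = gamma_quot (l - int (Suc k)) c"
    using gamma_quot_step[of c "l - int k"] by (auto simp: algebra_simps)
  then have "((fps_const (c + of_int (l - int k)) + fps_X) oo ?X) * (gamma_quot (l - int k) c oo ?X) =
      gamma_quot (l - int (Suc k)) c oo ?X"
    by (metis X0 fps_compose_mult_distrib)
  moreover have "(fps_const (c + of_int (l - int k)) + fps_X) oo ?X = fps_const (c + of_int (l - int k)) + ?X"
    using X0 by (simp only: fps_compose_add_distrib fps_const_compose fps_X_fps_compose_startby0)
  moreover have "pd_factor el i (Suc k) (c + of_int l - of_nat (Suc k)) =
      (fps_const (c + of_int (l - int k)) + ?X) * pd_factor el i k (c + of_int l - of_nat k)"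
    unfolding pd_factor_def prod.lessThan_Suc_shift by (simp add: algebra_simps)
  ultimately show ?case
    by (simp only: mult.assoc Suc.IH)
qed

text \<open>
Up to order r in t, differentiation acts on the coefficients by a shift even where there is a
pole: there the left-hand side is 0, and on the right-hand side the more than r zeros at m persist
at the smaller point \<open>m - k\<close>.
\<close>

lemma pd_factor_gamma_coeff:
  assumes pole: "\<And>i. \<lbrakk>v $ i \<in> neg_ints; v $ i + of_int (m $ i) \<notin> neg_ints\<rbrakk> \<Longrightarrow> r < card (new_negatives v m)"
    and s: "s \<le> r"
    and e: "\<And>i. e $ i + of_nat (k i) = v $ i + of_int (m $ i)"
  shows "fps_nth ((\<Prod>i\<in>UNIV. pd_factor el i (k i) (e $ i)) * gamma_coeff el v m) s =
    fps_nth (gamma_coeff el v (m - (\<chi> i. int (k i)))) s"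
proof (cases "\<exists>i. v $ i \<in> neg_ints \<and> v $ i + of_int (m $ i) \<notin> neg_ints")
  case True
  then obtain i where i: "v $ i \<in> neg_ints" "v $ i + of_int (m $ i) \<notin> neg_ints"
    by blast
  have "\<exists>i. gamma_quot (m $ i) (v $ i) oo (fps_const (of_int (el $ i)) * fps_X) = 0"
    using gamma_quot_pole[OF i] by (intro exI[of _ i]) simp
  then have "gamma_coeff el v m = 0"
    by (simp add: gamma_coeff_def)
  moreover have "new_negatives v m \<subseteq> new_negatives v (m - (\<chi> i. int (k i)))"
  proof
    fix j assume j: "j \<in> new_negatives v m"
    then obtain y where y: "y < 0" "v $ j + of_int (m $ j) = of_int y"
      by (auto simp: new_negatives_def elim: neg_intsE)
    have "v $ j + of_int ((m - (\<chi> i. int (k i))) $ j) = of_int (y - int (k j))"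
      unfolding of_int_diff y(2)[symmetric] by simp
    then show "j \<in> new_negatives v (m - (\<chi> i. int (k i)))"
      using j y(1) unfolding new_negatives_def mem_Collect_eq by (simp only: of_int_neg_ints) simp
  qed
  then have "s < card (new_negatives v (m - (\<chi> i. int (k i))))"
    using pole[OF i] s card_mono[OF finite] by (meson le_less_trans less_le_trans)
  ultimately show ?thesis
    by (simp add: gamma_coeff_vanish)
next
  case False
  have e': "e $ i = v $ i + of_int (m $ i) - of_nat (k i)" for i
    using e[of i] by (simp add: eq_diff_eq)
  have "pd_factor el i (k i) (e $ i) * (gamma_quot (m $ i) (v $ i) oo (fps_const (of_int (el $ i)) * fps_X)) =
      gamma_quot (m $ i - int (k i)) (v $ i) oo (fps_const (of_int (el $ i)) * fps_X)" for i
    unfolding e' using False by (intro pd_factor_gamma_quot) blast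
  then show ?thesis
    unfolding gamma_coeff_def prod.distrib[symmetric] by simp
qed

lemma cvec_add: "cvec (x + y) = cvec x + cvec y"
  by (simp add: vec_eq_iff cvec_def)

lemma cvec_scale: "cvec (z *s x) = of_int z *s cvec x"
  by (simp add: vec_eq_iff cvec_def)

lemma cvec_inj [simp]: "cvec x = cvec y \<longleftrightarrow> x = y"
  by (simp add: vec_eq_iff cvec_def)

lemma lattice_line_inj:
  assumes "el \<noteq> (0 :: int^'n)"
  shows "z *s el = z' *s el \<longleftrightarrow> z = z'"
  using assms by (auto simp: vec_eq_iff)

lemma lattice_coeff_point:
  assumes "el \<noteq> 0"
  shows "lattice_coeff el v lu (v + cvec (lu + z *s el)) = gamma_coeff el v (lu + z *s el)"
proof -
  have "{z'. v + cvec (lu + z *s el) = v + cvec (lu + z' *s el)} = {z}"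
    using lattice_line_inj[OF assms] by auto
  then show ?thesis
    by (simp add: lattice_coeff_def)
qed


section \<open>The differential equations\<close>

lemma log_poly_cong:
  assumes "\<And>s. s \<le> r \<Longrightarrow> fps_nth (C w) s = fps_nth (C' w') s"
  shows "log_poly r C w q = log_poly r C' w' q"
  using assms by (simp add: log_poly_def)

lemma pd_monom_lattice_coeff:
  fixes v :: "complex^'n::finite"
  assumes el: "el \<noteq> 0"
    and pole: "\<And>z i. \<lbrakk>v $ i \<in> neg_ints; v $ i + of_int ((lu + z *s el) $ i) \<notin> neg_ints\<rbrakk>
      \<Longrightarrow> r < card (new_negatives v (lu + z *s el))"
    and e: "e + (\<chi> i. of_nat (k i)) = v + cvec (lu + z *s el)"
  shows "pd_monom el k (log_poly r (lattice_coeff el v lu)) e q =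
    log_poly r (\<lambda>_. gamma_coeff el v (lu + z *s el - (\<chi> i. int (k i)))) e q"
  unfolding pd_monom_log_poly
proof (rule log_poly_cong)
  fix s assume s: "s \<le> r"
  have "e $ i + of_nat (k i) = v $ i + of_int ((lu + z *s el) $ i)" for i
    using arg_cong[OF e, of "\<lambda>x. x $ i"] by (simp add: cvec_def)
  then show "fps_nth ((\<Prod>i\<in>UNIV. pd_factor el i (k i) (e $ i)) *
        lattice_coeff el v lu (e + (\<chi> i. of_nat (k i)))) s =
      fps_nth (gamma_coeff el v (lu + z *s el - (\<chi> i. int (k i)))) s"
    unfolding e lattice_coeff_point[OF el] by (intro pd_factor_gamma_coeff[OF pole s]) auto
qed

text \<open>
The two monomials of the box operator differ by \<open>y el\<close>, so from a given exponent e they reach points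
that lie both or neither in \<open>v + lu + \<int> el\<close>. In the first case both monomials give the coefficient
at the common point \<open>e - v\<close>, up to order r in t; in the second case both give 0.
\<close>

lemma box_op_lattice_coeff:
  fixes v :: "complex^'n::finite"
  assumes el: "el \<noteq> 0"
    and pole: "\<And>z i. \<lbrakk>v $ i \<in> neg_ints; v $ i + of_int ((lu + z *s el) $ i) \<notin> neg_ints\<rbrakk>
      \<Longrightarrow> r < card (new_negatives v (lu + z *s el))"
  shows "box_op el (y *s el) (log_poly r (lattice_coeff el v lu)) = (\<lambda>e q. 0)"
proof (intro ext)
  fix e q
  let ?w = "y *s el"
  let ?k = "\<lambda>i. nat (?w $ i)" and ?k' = "\<lambda>i. nat (- ?w $ i)"
  let ?F = "log_poly r (lattice_coeff el v lu)"
  have split: "int (?k i) = ?w $ i + int (?k' i)" for i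
    by simp
  have shift: "e + (\<chi> i. of_nat (?k i)) = e + (\<chi> i. of_nat (?k' i)) + cvec ?w"
  proof -
    have "of_nat (?k i) = (of_nat (?k' i) + of_int (?w $ i) :: complex)" for i
      using arg_cong[OF split[of i], of "of_int :: int \<Rightarrow> complex"]
      by (simp only: of_int_add of_int_of_nat_eq add.commute)
    then show ?thesis
      by (simp only: vec_eq_iff cvec_def vector_add_component vec_lambda_beta add.assoc) simp
  qed
  have line: "lu + z *s el = lu + (z - y) *s el + ?w" for z
    by (simp add: vec.scale_left_diff_distrib)
  show "box_op el ?w ?F e q = 0"
  proof (cases "\<exists>z. e + (\<chi> i. of_nat (?k i)) = v + cvec (lu + z *s el)")
    case True
    then obtain z where z: "e + (\<chi> i. of_nat (?k i)) = v + cvec (lu + z *s el)"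
      by blast
    then have z': "e + (\<chi> i. of_nat (?k' i)) = v + cvec (lu + (z - y) *s el)"
      unfolding shift line[of z] cvec_add by (simp add: algebra_simps)
    have k: "pd_monom el ?k ?F e q = log_poly r (\<lambda>_. gamma_coeff el v (lu + z *s el - (\<chi> i. int (?k i)))) e q"
      by (rule pd_monom_lattice_coeff[OF el _ z]) (fact pole)
    have k': "pd_monom el ?k' ?F e q =
        log_poly r (\<lambda>_. gamma_coeff el v (lu + (z - y) *s el - (\<chi> i. int (?k' i)))) e q"
      by (rule pd_monom_lattice_coeff[OF el _ z']) (fact pole)
    have k_split: "(\<chi> i. int (?k i)) = ?w + (\<chi> i. int (?k' i))"
      unfolding vec_eq_iff vector_add_component vec_lambda_beta using split by blast
    have cancel: "x + w - (w + t) = x - t" for x w t :: "int^'n"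
      by simp
    have "lu + z *s el - (\<chi> i. int (?k i)) = lu + (z - y) *s el - (\<chi> i. int (?k' i))"
      unfolding line[of z] k_split by (rule cancel)
    then show ?thesis
      unfolding box_op_def k k' by (simp only: diff_self)
  next
    case False
    then have "lattice_coeff el v lu (e + (\<chi> i. of_nat (?k i))) = 0"
      by (simp only: lattice_coeff_def) simp
    moreover have "e + (\<chi> i. of_nat (?k' i)) \<noteq> v + cvec (lu + z *s el)" for z
    proof
      assume "e + (\<chi> i. of_nat (?k' i)) = v + cvec (lu + z *s el)"
      then have "e + (\<chi> i. of_nat (?k i)) = v + cvec (lu + (z + y) *s el)"
        unfolding shift by (simp add: cvec_add vec.scale_left_distrib)
      then show False
        using False by blast
    qed
    then have "lattice_coeff el v lu (e + (\<chi> i. of_nat (?k' i))) = 0"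
      by (simp only: lattice_coeff_def) simp
    ultimately show ?thesis
      unfolding box_op_def pd_monom_log_poly unfolding log_poly_def by simp
  qed
qed

lemma log_poly_lattice_coeff_support:
  assumes "log_poly r (lattice_coeff el v lu) w q \<noteq> 0"
  obtains z where "w = v + cvec (lu + z *s el)" "q \<le> r" "fps_nth (lattice_coeff el v lu w) (r - q) \<noteq> 0"
proof -
  from assms have *: "q \<le> r" "fps_nth (lattice_coeff el v lu w) (r - q) \<noteq> 0"
    by (auto simp: log_poly_def split: if_splits)
  then have "lattice_coeff el v lu w \<noteq> 0"
    by auto
  then have "{z. w = v + cvec (lu + z *s el)} \<noteq> {}"
    unfolding lattice_coeff_def by (metis sum.empty)
  with * that show ?thesis
    by blast
qed

text \<open>
\<open>x\<^sub>j \<partial>\<^sub>j\<close> differentiates \<open>x\<^sup>w\<close> and \<open>log x\<^sub>0\<close>. The logarithmic parts add up to 0 because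
\<open>\<Sum>\<^sub>j el\<^sub>j a\<^sub>j = 0\<close>, and the rest depends on w only through \<open>\<Sum>\<^sub>j w\<^sub>j a\<^sub>j\<close>.
\<close>

lemma euler_op_homogeneous:
  fixes F :: "'n::finite log_series" and a :: "'n \<Rightarrow> int^'d"
  assumes rel: "(\<Sum>j\<in>UNIV. el $ j *s a j) = 0"
    and supp: "\<And>e q. F e q \<noteq> 0 \<Longrightarrow> (\<Sum>j\<in>UNIV. e $ j *s cvec (a j)) = \<gamma>"
  shows "euler_op el a \<gamma> i F = (\<lambda>e q. 0)"
proof (intro ext)
  fix e q
  have pd: "mult_monom (axis j 1) (pd el j F) e q =
      e $ j * F e q + of_nat (q + 1) * of_int (el $ j) * F e (q + 1)" for j
    by (simp add: mult_monom_def pd_def)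
  have "(\<Sum>j\<in>UNIV. el $ j * a j $ i) = 0"
    using arg_cong[OF rel, of "\<lambda>x. x $ i"] by simp
  then have rel': "(\<Sum>j\<in>UNIV. of_int (a j $ i) * of_int (el $ j)) = (0 :: complex)"
    by (metis (no_types, lifting) mult.commute of_int_0 of_int_mult of_int_sum sum.cong)
  have "(\<Sum>j\<in>UNIV. of_int (a j $ i) * mult_monom (axis j 1) (pd el j F) e q) =
      (\<Sum>j\<in>UNIV. of_int (a j $ i) * e $ j) * F e q +
      (\<Sum>j\<in>UNIV. of_int (a j $ i) * of_int (el $ j)) * (of_nat (q + 1) * F e (q + 1))"
    unfolding pd sum_distrib_right sum.distrib[symmetric] by (intro sum.cong refl) (simp add: algebra_simps)
  also have "\<dots> = (\<Sum>j\<in>UNIV. e $ j *s cvec (a j)) $ i * F e q"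
    unfolding rel' by (simp add: cvec_def mult.commute)
  also have "\<dots> = \<gamma> $ i * F e q"
    using supp[of e q] by (cases "F e q = 0") auto
  finally show "euler_op el a \<gamma> i F e q = 0"
    by (simp add: euler_op_def)
qed

section \<open>Membership in the Nilsson ring\<close>

lemma nilsson_ringI:
  fixes F :: "'n::finite log_series"
  assumes supp: "\<And>w q. F w q \<noteq> 0 \<Longrightarrow> q \<le> r \<and> (\<exists>z \<ge> - int B. w = v + of_int z *s cvec el)"
    and el: "el \<noteq> 0"
  shows "F \<in> nilsson_ring el v"
proof -
  \<comment> \<open>N bounds the pole order in \<open>x\<^sub>0\<close> and the degree in \<open>log x\<^sub>0\<close>, and is at least 1, the power of \<open>x\<^sup>v\<close> that is used.\<close>
  define N where "N = Suc (B + r)"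
  define c where "c = (\<lambda>s. Abs_fps (\<lambda>k. F (v + of_int (int k - int N) *s cvec el) s))"
  define f where "f = (\<lambda>p s (m::nat). if p = N \<and> m = 1 then c s else 0)"
  have c: "fps_x0 el (c s) (v - of_nat N *s cvec el) s w q = (if s = q then F w q else 0)" for s w q
  proof -
    let ?Q = "{k. w = v - of_nat N *s cvec el + of_nat k *s cvec el}"
    have point: "v - of_nat N *s cvec el + of_nat k *s cvec el = v + of_int (int k - int N) *s cvec el" for k
      by (simp add: vec_eq_iff algebra_simps)
    have "(\<Sum>k\<in>?Q. fps_nth (c s) k) = (\<Sum>k\<in>?Q. F w s)"
      unfolding c_def point by (intro sum.cong) auto
    also have "\<dots> = F w s"
    proof (cases "F w s = 0")
      case True
      then show ?thesis
        by (simp only: sum.neutral_const)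
    next
      case False
      then obtain z where z: "z \<ge> - int B" "w = v + of_int z *s cvec el"
        using supp by blast
      have "of_int x *s cvec el = of_int y *s cvec el \<longleftrightarrow> x = y" for x y
        using lattice_line_inj[OF el] by (simp flip: cvec_scale)
      then have "?Q = {k. z = int k - int N}"
        unfolding point z(2) add_left_cancel by blast
      moreover have "z + int N \<ge> 0"
        using z(1) by (simp add: N_def)
      then have "z = int k - int N \<longleftrightarrow> k = nat (z + int N)" for k
        by linarith
      ultimately have "?Q = {nat (z + int N)}"
        by simp
      then show ?thesis
        by simp
    qed
    finally show ?thesis
      by (auto simp: fps_x0_def)
  qed
  have "fps_x0 el (f p s m) (of_nat m *s v - of_nat p *s cvec el) s w q =
      (if m = 1 then if s = q then if p = N then F w q else 0 else 0 else 0)" for p s m w q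
    using c[of s w q] by (auto simp: f_def fps_x0_def)
  moreover have "1 \<le> N"
    by (simp add: N_def)
  ultimately have "(\<Sum>p\<le>N. \<Sum>s\<le>N. \<Sum>m\<le>N. fps_x0 el (f p s m) (of_nat m *s v - of_nat p *s cvec el) s w q) =
      (if q \<le> N then F w q else 0)" for w q
    by simp
  moreover have "(if q \<le> N then F w q else 0) = F w q" for w q
    using supp[of w q] by (cases "F w q = 0") (auto simp: N_def)
  ultimately have "F = (\<lambda>w q. \<Sum>p\<le>N. \<Sum>s\<le>N. \<Sum>m\<le>N. fps_x0 el (f p s m) (of_nat m *s v - of_nat p *s cvec el) s w q)"
    by simp
  then show ?thesis
    unfolding nilsson_ring_def by blast
qed


section \<open>The series as a Taylor coefficient\<close>

lemma count_list_map_sorted_list_of_set: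
  assumes "finite T"
  shows "count_list (map p (sorted_list_of_set T)) i = card {t\<in>T. p t = i}"
proof -
  have "count_list (map p (sorted_list_of_set T)) i = length (filter (\<lambda>t. p t = i) (sorted_list_of_set T))"
    by (simp add: count_list_eq_length_filter filter_map o_def eq_commute)
  also have "\<dots> = card (set (filter (\<lambda>t. p t = i) (sorted_list_of_set T)))"
    by (intro distinct_card[symmetric]) simp
  finally show ?thesis
    using assms by simp
qed

text \<open>
Minimality excludes that the negative support just shrinks: if it changes, it gains an
element.
\<close>

lemma minimal_nsupp_new_negative:
  fixes v :: "complex^'n::finite"
  assumes "minimal_nsupp a v I u" "m \<in> Lset a u" "nsupp I (v + cvec m) \<noteq> nsupp I v"
  shows "I \<inter> new_negatives v m \<noteq> {}"
  using assms by (auto simp: minimal_nsupp_def nsupp_def new_negatives_def cvec_def)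

text \<open>
The restriction of z in \<open>Phi\<close> can be dropped: if z is excluded, minimality gives an index
outside Q that is newly negative, and its factor \<open>M\<^bsub>m,0\<^esub>(v\<^sub>i)\<close> is 0.
\<close>

lemma Phi_lattice_point:
  fixes v :: "complex^'n::finite"
  assumes el: "ell K l \<noteq> 0"
    and m: "lu + z *s ell K l \<in> Lset a u"
    and min: "minimal_nsupp a v (- set Q) u"
  shows "Phi K l v lu Q (v + cvec (lu + z *s ell K l)) 0 =
    (\<Prod>i\<in>UNIV. fact (count_list Q i) * Mc ((lu + z *s ell K l) $ i) (count_list Q i) (v $ i))"
proof -
  let ?m = "lu + z *s ell K l"
  let ?h = "\<lambda>i. fact (count_list Q i) * Mc (?m $ i) (count_list Q i) (v $ i)"
  have line: "{z'. v + cvec ?m = v + cvec (lu + z' *s ell K l)} = {z}"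
    using lattice_line_inj[OF el] by auto
  have K: "(\<Prod>i\<in>K. fact (count_list Q i) * Mc (lu $ i + z * l i) (count_list Q i) (v $ i)) = prod ?h K"
    by (intro prod.cong) (auto simp: ell_def sgn_coeff_def)
  have mK: "(\<Prod>i\<in>- K. fact (count_list Q i) * Mc (lu $ i - z * l i) (count_list Q i) (v $ i)) = prod ?h (- K)"
    by (intro prod.cong) (auto simp: ell_def sgn_coeff_def)
  have all: "prod ?h K * prod ?h (- K) = prod ?h UNIV"
    by (subst prod.union_disjoint[symmetric]) auto
  have "Phi K l v lu Q (v + cvec ?m) 0 = (if z \<in> Zset (ell K l) v (- set Q) lu then prod ?h UNIV else 0)"
  proof -
    have "{z'. z' \<in> Zset (ell K l) v (- set Q) lu \<and> v + cvec ?m = v + cvec (lu + z' *s ell K l)} =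
        (if z \<in> Zset (ell K l) v (- set Q) lu then {z} else {})"
      using line by (auto simp del: cvec_inj add_left_cancel)
    then show ?thesis
      using all by (simp only: Phi_def if_True) (simp add: K mK)
  qed
  moreover have "prod ?h UNIV = 0" if "z \<notin> Zset (ell K l) v (- set Q) lu"
  proof -
    have "nsupp (- set Q) (v + cvec ?m) \<noteq> nsupp (- set Q) v"
      using that by (simp add: Zset_def)
    then obtain i where i: "i \<notin> set Q" "i \<in> new_negatives v ?m"
      using minimal_nsupp_new_negative[OF min m] by blast
    then have "fps_nth (gamma_quot (?m $ i) (v $ i)) 0 = 0"
      using gamma_quot_new_negative unfolding new_negatives_def by blast
    then have "?h i = 0"
      using i(1) by (simp only: count_list_0_iff[THEN iffD2] gamma_quot_def fps_nth_Abs_fps) simp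
    then show ?thesis
      by (intro prod_zero) auto
  qed
  ultimately show ?thesis
    by simp
qed

lemma Phi_outside_lattice:
  assumes "\<nexists>z. w = v + cvec (lu + z *s ell K l)"
  shows "Phi K l v lu Q w q = 0"
  using assms by (simp add: Phi_def)

text \<open>
Only the terms with \<open>s = r - q\<close> contribute to \<open>log\<^sup>q x\<^sub>0\<close>. For a fixed set T, the sum over the functions
p is \<open>(r - q)!\<close> times a coefficient of a product of Gamma quotients by the Leibniz rule, and there are
\<open>r choose (r - q)\<close> sets T; together they give the factor \<open>r! / q!\<close> of \<open>log_poly\<close>. The sets
Q that occur have at most r elements, so minimality applies to their complements.
\<close>

lemma S_series_eq_log_poly:
  fixes v :: "complex^'n::finite"
  assumes el: "ell K l \<noteq> 0"
    and m: "\<And>z. lu + z *s ell K l \<in> Lset a u"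
    and min: "\<And>I. card I \<ge> CARD('n) - r \<Longrightarrow> minimal_nsupp a v I u"
  shows "S_series K l v lu r = log_poly r (lattice_coeff (ell K l) v lu)"
proof (intro ext)
  fix w q
  let ?el = "ell K l"
  let ?Q = "\<lambda>p T. map p (sorted_list_of_set T)"
  let ?P = "\<lambda>T p. (\<Prod>t\<in>T. of_int (sgn_coeff K (p t) * l (p t))) * Phi K l v lu (?Q p T) w 0"
  have log: "mult_log k (Phi K l v lu Q) w q = (if q = k then Phi K l v lu Q w 0 else 0)" for k Q
    by (auto simp: mult_log_def Phi_def)
  have "S_series K l v lu r w q = (\<Sum>s\<in>{0..r}. if q = r - s
      then \<Sum>T | T \<subseteq> {1..r} \<and> card T = s. \<Sum>p\<in>T \<rightarrow>\<^sub>E UNIV. ?P T p else 0)"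
    unfolding S_series_def log by (intro sum.cong) (auto intro!: sum.neutral)
  also have "\<dots> = (\<Sum>s\<in>{0..r}. if s = r - q then if q \<le> r
      then \<Sum>T | T \<subseteq> {1..r} \<and> card T = s. \<Sum>p\<in>T \<rightarrow>\<^sub>E UNIV. ?P T p else 0 else 0)"
    by (intro sum.cong) auto
  also have "\<dots> = (if q \<le> r
      then \<Sum>T | T \<subseteq> {1..r} \<and> card T = r - q. \<Sum>p\<in>T \<rightarrow>\<^sub>E UNIV. ?P T p else 0)"
    by simp
  also have "\<dots> = log_poly r (lattice_coeff ?el v lu) w q"
  proof (cases "\<exists>z. w = v + cvec (lu + z *s ?el)")
    case False
    then have "lattice_coeff ?el v lu w = 0"
      by (simp add: lattice_coeff_def)
    then show ?thesis
      using Phi_outside_lattice[OF False] by (simp add: log_poly_def)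
  next
    case True
    then obtain z where w: "w = v + cvec (lu + z *s ?el)"
      by blast
    let ?m = "lu + z *s ?el"
    have inner: "(\<Sum>p\<in>T \<rightarrow>\<^sub>E UNIV. ?P T p) = fact (card T) * fps_nth (gamma_coeff ?el v ?m) (card T)"
      if T: "T \<subseteq> {1..r}" for T
    proof -
      have fin: "finite T"
        using T finite_subset by blast
      let ?H = "\<lambda>i. gamma_quot (?m $ i) (v $ i) oo (fps_const (of_int (?el $ i)) * fps_X)"
      have H: "fps_nth (?H i) s = of_int (?el $ i) ^ s * Mc (?m $ i) s (v $ i)" for i s
        by (simp add: fps_compose_linear gamma_quot_def)
      have "?P T p = (\<Prod>i\<in>UNIV. fact (card {t\<in>T. p t = i}) * fps_nth (?H i) (card {t\<in>T. p t = i}))" for p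
      proof -
        let ?c = "\<lambda>i. card {t\<in>T. p t = i}"
        have "card (set (?Q p T)) \<le> r"
          using card_image_le[OF fin, of p] card_mono[OF _ T] fin by simp
        then have "card (- set (?Q p T)) \<ge> CARD('n) - r"
          by (simp add: Compl_eq_Diff_UNIV card_Diff_subset)
        then have "Phi K l v lu (?Q p T) w 0 = (\<Prod>i\<in>UNIV. fact (?c i) * Mc (?m $ i) (?c i) (v $ i))"
          unfolding w by (subst Phi_lattice_point[OF el m min]) (simp_all only: count_list_map_sorted_list_of_set[OF fin])
        moreover have "(\<Prod>t\<in>T. of_int (sgn_coeff K (p t) * l (p t))) = (\<Prod>i\<in>UNIV. of_int (?el $ i) ^ ?c i :: complex)"
          using prod.group[OF fin finite subset_UNIV, of "\<lambda>t. of_int (?el $ p t) :: complex" p, symmetric]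
          by (simp add: ell_def)
        ultimately show ?thesis
          by (simp only: H prod.distrib) (simp only: mult_ac)
      qed
      then show ?thesis
        unfolding gamma_coeff_def by (simp only: fps_nth_prod_multinomial[OF finite fin])
    qed
    have point: "lattice_coeff ?el v lu w = gamma_coeff ?el v ?m"
      unfolding w by (rule lattice_coeff_point[OF el])
    show ?thesis
    proof (cases "q \<le> r")
      case True
      have "(\<Sum>T | T \<subseteq> {1..r} \<and> card T = r - q. \<Sum>p\<in>T \<rightarrow>\<^sub>E UNIV. ?P T p) =
          (\<Sum>T | T \<subseteq> {1..r} \<and> card T = r - q. fact (r - q) * fps_nth (gamma_coeff ?el v ?m) (r - q))"
        using inner by (intro sum.cong) auto
      also have "\<dots> = of_nat (r choose (r - q)) * fact (r - q) * fps_nth (gamma_coeff ?el v ?m) (r - q)"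
        using n_subsets[of "{1..r}" "r - q"] by simp
      also have "\<dots> = fact r / fact q * fps_nth (gamma_coeff ?el v ?m) (r - q)"
        using True by (simp add: binomial_fact)
      finally show ?thesis
        using True by (simp only: log_poly_def point if_True)
    qed (simp add: log_poly_def)
  qed
  finally show "S_series K l v lu r w q = log_poly r (lattice_coeff ?el v lu) w q" .
qed

section \<open>Poles, zeros and the main result\<close>

text \<open>
Off its newly negative indices, the negative support at m is contained in that of v, and a pole makes
the inclusion strict. So the complement of the set of these indices has to be too small for minimality.
\<close>

lemma card_new_negatives_at_pole:
  fixes v :: "complex^'n::finite"
  assumes min: "\<And>I. card I \<ge> CARD('n) - r \<Longrightarrow> minimal_nsupp a v I u"
    and m: "m \<in> Lset a u" and i: "v $ i \<in> neg_ints" "v $ i + of_int (m $ i) \<notin> neg_ints"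
  shows "r < card (new_negatives v m)"
proof (rule ccontr)
  assume "\<not> r < card (new_negatives v m)"
  then have "minimal_nsupp a v (- new_negatives v m) u"
    by (intro min) (simp add: Compl_eq_Diff_UNIV card_Diff_subset)
  moreover have "nsupp (- new_negatives v m) (v + cvec m) \<noteq> nsupp (- new_negatives v m) v"
    using i by (auto simp: nsupp_def new_negatives_def cvec_def)
  ultimately show False
    using minimal_nsupp_new_negative[OF _ m] by blast
qed

text \<open>
The indices in \<open>M_set K v\<close> belong to K, where the coefficients of \<open>ell K l\<close> are positive; so
their entries all become negative as z decreases.
\<close>

lemma M_set_eventually_new_negatives:
  fixes v :: "complex^'n::finite"
  assumes l: "\<And>p. l p > 0"
  shows "\<exists>B. \<forall>z < - int B. M_set K v \<subseteq> new_negatives v (lu + z *s ell K l)"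
proof -
  have "\<forall>i. \<exists>n. v $ i \<in> \<nat> \<longrightarrow> v $ i = of_nat n"
    by (auto elim: Nats_cases)
  then obtain n where n: "\<And>i. v $ i \<in> \<nat> \<Longrightarrow> v $ i = of_nat (n i)"
    by metis
  define B where "B = (\<Sum>i\<in>UNIV. n i + nat \<bar>lu $ i\<bar>)"
  show ?thesis
  proof (intro exI[of _ B] allI impI subsetI)
    fix z i assume z: "z < - int B" and i: "i \<in> M_set K v"
    have "n i + nat \<bar>lu $ i\<bar> \<le> B"
      unfolding B_def by (intro member_le_sum) auto
    moreover have "z * l i \<le> z * 1"
      using z l[of i] by (intro mult_left_mono_neg) auto
    ultimately have neg: "int (n i) + (lu $ i + z * l i) < 0"
      using z by linarith
    have vi: "v $ i = of_int (int (n i))"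
      using i n by (simp add: M_set_def)
    have mi: "(lu + z *s ell K l) $ i = lu $ i + z * l i"
      using i by (simp add: M_set_def ell_def sgn_coeff_def)
    show "i \<in> new_negatives v (lu + z *s ell K l)"
      unfolding new_negatives_def mem_Collect_eq mi vi of_int_add[symmetric] of_int_neg_ints
      using neg by simp
  qed
qed


lemma E'_set_sum:
  assumes "codim_one a K l" "\<beta> \<in> VC a" "v \<in> E'_set a K l \<beta>"
  shows "(\<Sum>j\<in>UNIV. v $ j *s cvec (a j)) = \<beta>"
proof -
  obtain i b where "v = exponent a \<beta> i b"
    using assms(3) by (auto simp: E'_set_def E_set_def)
  then show ?thesis
    using theI'[OF exponent_ex1[OF assms(1,2), of i b]] by (simp add: exponent_def)
qed

lemma Lset_line:
  fixes el :: "int^'n::finite"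
  assumes rel: "(\<Sum>j\<in>UNIV. el $ j *s a j) = 0"
  shows "lu + z *s el \<in> Lset a u \<longleftrightarrow> lu \<in> Lset a u"
proof -
  have "(\<Sum>j\<in>UNIV. (lu + z *s el) $ j *s a j) =
      (\<Sum>j\<in>UNIV. lu $ j *s a j) + z *s (\<Sum>j\<in>UNIV. el $ j *s a j)"
    by (simp add: vec_eq_iff sum.distrib sum_distrib_left distrib_right mult.assoc)
  then show ?thesis
    by (simp add: Lset_def rel)
qed

lemma Lset_cvec:
  assumes "m \<in> Lset a u"
  shows "(\<Sum>j\<in>UNIV. cvec m $ j *s cvec (a j)) = cvec u"
proof -
  have "(\<Sum>j\<in>UNIV. m $ j * a j $ i) = u $ i" for i
    using assms by (auto simp: Lset_def)
  then have "of_int (\<Sum>j\<in>UNIV. m $ j * a j $ i) = (of_int (u $ i) :: complex)" for i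
    by (simp only:)
  then show ?thesis
    by (simp add: vec_eq_iff cvec_def)
qed

theorem theorem6p5:
  fixes a :: "'n::finite \<Rightarrow> int^'d" and K :: "'n set" and l :: "'n \<Rightarrow> int"
    and \<beta> :: "complex^'d" and v :: "complex^'n" and u :: "int^'d" and lu :: "int^'n" and r :: nat
  assumes "codim_one a K l"
    and "\<beta> \<in> VC a"
    and "v \<in> E'_set a K l \<beta>"
    and "u \<in> ZA a"
    and "(\<Sum>\<sigma>\<in>UNIV. lu $ \<sigma> *s a \<sigma>) = u"
    and "r < card (M_set K v)"
    and "\<And>I. card I \<ge> CARD('n) - r \<Longrightarrow> minimal_nsupp a v I u"
  shows "is_solution (ell K l) a (\<beta> + cvec u) (S_series K l v lu r)
    \<and> S_series K l v lu r \<in> mult_monom (cvec lu) ` nilsson_ring (ell K l) v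
    \<and> (u = 0 \<longrightarrow> S_series K l v lu r \<in> nilsson_ring (ell K l) v)"
proof -
  let ?el = "ell K l"
  let ?S = "S_series K l v lu r"
  have l: "l p > 0" for p
    using assms(1) by (simp add: codim_one_def)
  have el: "?el \<noteq> 0"
  proof
    assume "?el = 0"
    then have "?el $ undefined = 0"
      by simp
    then show False
      using l[of undefined] by (simp add: ell_def sgn_coeff_def split: if_splits)
  qed
  have L0: "Lset a 0 = range (\<lambda>z. z *s ?el)"
    using assms(1) by (simp add: codim_one_def)
  have "1 *s ?el \<in> Lset a 0"
    unfolding L0 by blast
  then have rel: "(\<Sum>j\<in>UNIV. ?el $ j *s a j) = 0"
    by (simp add: Lset_def)
  have m: "lu + z *s ?el \<in> Lset a u" for z
    unfolding Lset_line[OF rel] using assms(5) by (simp add: Lset_def)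
  have S: "?S = log_poly r (lattice_coeff ?el v lu)"
    using S_series_eq_log_poly[OF el m assms(7)] .
  have pole: "r < card (new_negatives v (lu + z *s ?el))"
    if "v $ i \<in> neg_ints" "v $ i + of_int ((lu + z *s ?el) $ i) \<notin> neg_ints" for z i
    by (rule card_new_negatives_at_pole[OF assms(7) m that])
  have box: "box_op ?el (y *s ?el) ?S = (\<lambda>e q. 0)" for y
    unfolding S by (rule box_op_lattice_coeff[OF el]) (rule pole)
  obtain B where B: "\<And>z. z < - int B \<Longrightarrow> M_set K v \<subseteq> new_negatives v (lu + z *s ?el)"
    using M_set_eventually_new_negatives[where K = K and l = l and v = v and lu = lu, OF l] by blast
  have supp: "q \<le> r \<and> (\<exists>z \<ge> - int B. w = v + cvec (lu + z *s ?el))" if nz: "?S w q \<noteq> 0" for w q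
  proof -
    obtain z where z: "w = v + cvec (lu + z *s ?el)" "q \<le> r" "fps_nth (lattice_coeff ?el v lu w) (r - q) \<noteq> 0"
      using nz unfolding S by (rule log_poly_lattice_coeff_support)
    have "\<not> z < - int B"
    proof
      assume "z < - int B"
      then have "r < card (new_negatives v (lu + z *s ?el))"
        using assms(6) card_mono[OF finite B] by (meson less_le_trans)
      then have "fps_nth (gamma_coeff ?el v (lu + z *s ?el)) (r - q) = 0"
        by (intro gamma_coeff_vanish) simp
      then show False
        using z(3) unfolding z(1) lattice_coeff_point[OF el] by simp
    qed
    then have "z \<ge> - int B"
      by simp
    then show ?thesis
      using z(1,2) by blast
  qed
  have euler: "euler_op ?el a (\<beta> + cvec u) i ?S = (\<lambda>e q. 0)" for i
  proof (rule euler_op_homogeneous[OF rel])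
    fix e q assume "?S e q \<noteq> 0"
    then obtain z where e: "e = v + cvec (lu + z *s ?el)"
      using supp by blast
    let ?m = "lu + z *s ?el"
    have "(\<Sum>j\<in>UNIV. e $ j *s cvec (a j)) =
        (\<Sum>j\<in>UNIV. v $ j *s cvec (a j)) + (\<Sum>j\<in>UNIV. cvec ?m $ j *s cvec (a j))"
      unfolding e sum.distrib[symmetric] by (simp add: vec.scale_left_distrib)
    then show "(\<Sum>j\<in>UNIV. e $ j *s cvec (a j)) = \<beta> + cvec u"
      by (simp only: Lset_cvec[OF m] E'_set_sum[OF assms(1-3)])
  qed
  have "?S = mult_monom (cvec lu) (\<lambda>w. ?S (w + cvec lu))"
    by (simp add: mult_monom_def)
  moreover have "(\<lambda>w. ?S (w + cvec lu)) \<in> nilsson_ring ?el v"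
  proof (rule nilsson_ringI[OF _ el])
    fix w q assume "?S (w + cvec lu) q \<noteq> 0"
    from supp[OF this] obtain z where "q \<le> r" "z \<ge> - int B" "w + cvec lu = v + cvec (lu + z *s ?el)"
      by blast
    moreover from this(3) have "w = v + of_int z *s cvec ?el"
      by (simp add: cvec_add cvec_scale algebra_simps)
    ultimately show "q \<le> r \<and> (\<exists>z \<ge> - int B. w = v + of_int z *s cvec ?el)"
      by blast
  qed
  ultimately have shifted: "?S \<in> mult_monom (cvec lu) ` nilsson_ring ?el v"
    by (rule image_eqI)
  have unshifted: "?S \<in> nilsson_ring ?el v" if "u = 0"
  proof -
    have "lu \<in> Lset a 0"
      using assms(5) that by (simp add: Lset_def)
    then obtain z0 where z0: "lu = z0 *s ?el"
      unfolding L0 by blast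
    \<comment> \<open>Now \<open>x\<^bsup>lu\<^esup>\<close> is a power of \<open>x\<^sub>0\<close>, and only the bound on the powers of \<open>x\<^sub>0\<close> changes.\<close>
    show ?thesis
    proof (rule nilsson_ringI[OF _ el])
      fix w q assume "?S w q \<noteq> 0"
      from supp[OF this] obtain z where z: "q \<le> r" "z \<ge> - int B" "w = v + cvec (lu + z *s ?el)"
        by blast
      have "w = v + of_int (z0 + z) *s cvec ?el"
        unfolding z(3) z0 by (simp add: cvec_add cvec_scale vec.scale_left_distrib)
      moreover have "z0 + z \<ge> - int (B + nat \<bar>z0\<bar>)"
        using z(2) by linarith
      ultimately show "q \<le> r \<and> (\<exists>z \<ge> - int (B + nat \<bar>z0\<bar>). w = v + of_int z *s cvec ?el)"
        using z(1) by blast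
    qed
  qed
  show ?thesis
    using box euler shifted unshifted by (auto simp: is_solution_def)
qed

end
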